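(* Let $n\ge 6$ be an even integer, $t=n/2$, let $W_1,\ldots,W_{3^t+1}$ be $t$-dimensional subspaces of $\mathbb{F}_3^n$ with pairwise intersection $\{\mathbf{0}\}$, let $1\le s\le 3^t+1$, let $\mathcal{A}=\{i_1,\ldots,i_s\}\subseteq\{1,\ldots,3^t+1\}$ be a set of $s$ distinct indices, and let $f=\sum_{i\in\mathcal{A}} f_i:\mathbb{F}_3^n\to\mathbb{F}_3$ (with $f_i$ as defined in the context). If $s\notin\{1,3^t,3^t+1\}$, then $\mathscr{C}_f$ is a $[3^n-1,n+1]$ minimal linear code over $\mathbb{F}_3$. Moreover, if $s\le 3^{t-2}$, then $\frac{\mathrm{wt}_{min}}{\mathrm{wt}_{max}}\le\frac13<\frac23$, where $\mathrm{wt}_{min}$ and $\mathrm{wt}_{max}$ are the minimum and maximum nonzero Hamming weights of $\mathscr{C}_f$.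
   Context: For $i\in\{1,\ldots,3^t+1\}$, $f_i:\mathbb{F}_3^n\to\mathbb{F}_3$ is defined by $f_i(\mathbf{x})=1$ if $\mathbf{x}\in W_i\setminus\{\mathbf{0}\}$ and $f_i(\mathbf{x})=0$ otherwise. For a function $f:\mathbb{F}_3^n\to\mathbb{F}_3$, $$\mathscr{C}_f=\{(\alpha f(\mathbf{x})+\mathbf{w}\cdot\mathbf{x})_{\mathbf{x}\in\mathbb{F}_3^n\setminus\{\mathbf{0}\}} \mid \alpha\in\mathbb{F}_3,\ \mathbf{w}\in\mathbb{F}_3^n\},$$ where $\cdot$ is the standard inner product; coordinates are indexed by the nonzero vectors of $\mathbb{F}_3^n$. An $[N,k]$ linear code over $\mathbb{F}_3$ is a $k$-dimensional subspace of $\mathbb{F}_3^N$. The support $\mathrm{Supp}(\mathbf{c})$ of a codeword is the set of coordinates where it is nonzero, and its Hamming weight is the size of its support. A codeword $\mathbf{c}_2$ covers $\mathbf{c}_1$ if $\mathrm{Supp}(\mathbf{c}_1)\subseteq\mathrm{Supp}(\mathbf{c}_2)$. A nonzero codeword $\mathbf{c}$ is minimal if the only nonzero codewords it covers are $\alpha\mathbf{c}$ with $\alpha\in\mathbb{F}_3^*$; a code is minimal if every nonzero codeword in it is minimal. *)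

theory Defs
  imports "HOL-Analysis.Analysis"
begin

text \<open>The library type \<open>Enum.finite_3\<close> carries the field structure of the integers modulo 3.\<close>

type_synonym F3 = Enum.finite_3

text \<open>
  A code of length \<open>N\<close> over a field \<open>'a\<close> is a set of vectors \<open>'a ^ 'm\<close>, where \<open>'m\<close> is a finite
  type of coordinates with \<open>N\<close> elements.
\<close>

definition linear_code :: "nat \<Rightarrow> nat \<Rightarrow> ('a::field ^ 'm::finite) set \<Rightarrow> bool" where
  "linear_code N k C \<longleftrightarrow> CARD('m) = N \<and> vec.subspace C \<and> vec.dim C = k"

definition Supp :: "'a::zero ^ 'm::finite \<Rightarrow> 'm set" where
  "Supp c = {j. c $ j \<noteq> 0}"

definition hamming_weight :: "'a::zero ^ 'm::finite \<Rightarrow> nat" where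
  "hamming_weight c = card (Supp c)"

definition covers :: "'a::zero ^ 'm::finite \<Rightarrow> 'a ^ 'm \<Rightarrow> bool" where
  "covers c2 c1 \<longleftrightarrow> Supp c1 \<subseteq> Supp c2"

definition minimal_codeword :: "('a::field ^ 'm::finite) set \<Rightarrow> 'a ^ 'm \<Rightarrow> bool" where
  "minimal_codeword C c \<longleftrightarrow>
     c \<in> C \<and> c \<noteq> 0 \<and> (\<forall>c'\<in>C. c' \<noteq> 0 \<longrightarrow> covers c c' \<longrightarrow> (\<exists>\<alpha>. \<alpha> \<noteq> 0 \<and> c' = \<alpha> *s c))"

definition minimal_code :: "('a::field ^ 'm::finite) set \<Rightarrow> bool" where
  "minimal_code C \<longleftrightarrow> (\<forall>c\<in>C. c \<noteq> 0 \<longrightarrow> minimal_codeword C c)"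

text \<open>For finite \<open>'a\<close>, and a code with a nonzero codeword, these extrema are over a finite
  nonempty set.\<close>

definition wt_min :: "('a::zero ^ 'm::finite) set \<Rightarrow> nat" where
  "wt_min C = Min (hamming_weight ` (C - {0}))"

definition wt_max :: "('a::zero ^ 'm::finite) set \<Rightarrow> nat" where
  "wt_max C = Max (hamming_weight ` (C - {0}))"

text \<open>The coordinates of the codes below are the nonzero vectors of \<open>'a ^ 'n\<close>.\<close>

typedef (overloaded) ('a::zero_neq_one, 'n::finite) nonzero_vec = "{x :: 'a ^ 'n. x \<noteq> 0}"
  by (rule exI[of _ 1]) (simp add: vec_eq_iff)

instance nonzero_vec :: ("{zero_neq_one, finite}", finite) finite
proof
  have "inj (Rep_nonzero_vec :: ('a, 'b) nonzero_vec \<Rightarrow> 'a ^ 'b)"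
    by (simp add: inj_def Rep_nonzero_vec_inject)
  then show "finite (UNIV :: ('a, 'b) nonzero_vec set)"
    by (rule finite_imageD[rotated]) (rule finite)
qed

definition dot :: "'a::comm_ring_1 ^ 'n::finite \<Rightarrow> 'a ^ 'n \<Rightarrow> 'a" where
  "dot w x = (\<Sum>i\<in>UNIV. w $ i * x $ i)"

definition code_of :: "('a::{field, finite} ^ 'n::finite \<Rightarrow> 'a) \<Rightarrow> ('a ^ ('a, 'n) nonzero_vec) set" where
  "code_of f =
     {(\<chi> j. \<alpha> * f (Rep_nonzero_vec j) + dot w (Rep_nonzero_vec j)) | \<alpha> w. True}"

definition nonzero_indicator :: "('a::zero_neq_one ^ 'n::finite) set \<Rightarrow> 'a ^ 'n \<Rightarrow> 'a" where
  "nonzero_indicator V x = (if x \<in> V - {0} then 1 else 0)"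

end

theory Submission
  imports Defs
begin

text \<open>
  Suppose one codeword covers another that is not a multiple of it. If the covering word is
  \<open>v \<bullet> x\<close>, the covered one vanishes on the hyperplane \<open>v\<^sup>\<bottom>\<close>, where \<open>f\<close> would then be
  linear; since \<open>f\<close> is even and \<open>v\<^sup>\<bottom>\<close> meets every \<open>W\<^sub>i\<close> nontrivially, this is impossible.
  Otherwise the covering word is \<open>f + v \<bullet> x\<close> after scaling, and after subtracting a multiple of it
  one may assume that the covered one is \<open>w \<bullet> x\<close>; the zeros of \<open>f + v \<bullet> x\<close> then force \<open>w\<close> to
  vanish on two different \<open>W\<^sub>i\<close>, whose sum is the whole space, or on \<open>v\<^sup>\<bottom>\<close> and on one
  \<open>W\<^sub>i\<close> not contained in \<open>v\<^sup>\<bottom>\<close>; hence \<open>w = 0\<close>.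
  The weight ratio is bounded by comparing the codewords of \<open>f\<close> and of a coordinate function.
\<close>

text \<open>These default simplification rules unfold 0 and 1 to constructors, out of reach of the ring
  rules.\<close>

declare zero_finite_3_def [simp del] one_finite_3_def [simp del]

lemma F3_neq_0_cases:
  fixes a :: F3
  assumes "a \<noteq> 0"
  shows "a = 1 \<or> a = - 1"
  using assms by (cases a) (auto simp: zero_finite_3_def one_finite_3_def uminus_finite_3_def)

lemma F3_minus_eq_self: "- a = a \<longleftrightarrow> a = 0" for a :: F3
  by (cases a) (auto simp: zero_finite_3_def uminus_finite_3_def)

lemma card_F3: "CARD(F3) = 3"
  by (simp add: UNIV_finite_3)

section \<open>The standard inner product\<close>

lemma dot_add_right: "dot w (x + y) = dot w x + dot w y"
  by (simp add: dot_def distrib_left sum.distrib)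

lemma dot_diff_right: "dot w (x - y) = dot w x - dot w y"
  by (simp add: dot_def right_diff_distrib sum_subtractf)

lemma dot_scale_right: "dot w (c *s x) = c * dot w x"
  by (simp add: dot_def sum_distrib_left ac_simps)

lemma dot_minus_right: "dot w (- x) = - dot w x"
  by (simp add: dot_def sum_negf)

lemma dot_zero_right [simp]: "dot w 0 = 0"
  by (simp add: dot_def)

lemma dot_diff_left: "dot (v - w) x = dot v x - dot w x"
  by (simp add: dot_def left_diff_distrib sum_subtractf)

lemma dot_scale_left: "dot (c *s w) x = c * dot w x"
  by (simp add: dot_def sum_distrib_left ac_simps)

lemma dot_zero_left [simp]: "dot 0 x = 0"
  by (simp add: dot_def)

lemma dot_axis: "dot w (axis k 1) = w $ k"
proof -
  have "dot w (axis k 1) = (\<Sum>i\<in>UNIV. if i = k then w $ i else 0)"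
    unfolding dot_def by (rule sum.cong) (auto simp: axis_def)
  then show ?thesis by simp
qed

lemma dot_eq_0_imp_eq_0:
  assumes "\<And>x. dot w x = 0"
  shows "w = 0"
  using assms[of "axis _ 1"] by (simp add: vec_eq_iff dot_axis)

text \<open>Choosing \<open>k\<close> with \<open>v $ k\<close> nonzero, the vectors
  \<open>v $ k *s axis i 1 - v $ i *s axis k 1\<close> are orthogonal to \<open>v\<close>.
  Evaluating \<open>w\<close> on them shows that its coordinates are proportional to those of
  \<open>v\<close>.\<close>

lemma orthogonal_subset_imp_multiple:
  fixes v w :: "'a::field ^ 'n::finite"
  assumes "v \<noteq> 0" and vanish: "\<And>x. dot v x = 0 \<Longrightarrow> dot w x = 0"
  obtains c where "w = c *s v"
proof -
  obtain k where k: "v $ k \<noteq> 0"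
    using assms(1) by (auto simp: vec_eq_iff)
  have "v $ k * w $ i = v $ i * w $ k" for i
    using vanish[of "v $ k *s axis i 1 - v $ i *s axis k 1"]
    by (simp add: dot_diff_right dot_scale_right dot_axis)
  then have "w = (w $ k / v $ k) *s v"
    using k by (simp add: vec_eq_iff field_simps)
  then show thesis by (rule that)
qed

section \<open>Dimension and cardinality of subspaces\<close>

lemma complementary_subspaces_sum:
  fixes S T :: "('a::field ^ 'n::finite) set"
  assumes "vec.subspace S" "vec.subspace T" "S \<inter> T = {0}" "vec.dim S + vec.dim T = CARD('n)"
  obtains y z where "x = y + z" "y \<in> S" "z \<in> T"
proof -
  let ?ST = "{y + z | y z. y \<in> S \<and> z \<in> T}"
  have "vec.dim ?ST = CARD('n)"
    using vec.dim_sums_Int[OF assms(1,2)] assms(3,4) by simp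
  then have "vec.dim (UNIV :: ('a ^ 'n) set) \<le> vec.dim ?ST"
    by (simp only: vec_dim_card)
  then have "?ST = UNIV"
    by (intro vec.subspace_dim_equal vec.subspace_sums assms vec.subspace_UNIV subset_UNIV)
  then have "x \<in> ?ST" by simp
  then obtain y z where "x = y + z" "y \<in> S" "z \<in> T" by blast
  then show thesis by (rule that)
qed

lemma subspace_meets_hyperplane:
  fixes S :: "('a::field ^ 'n::finite) set"
  assumes S: "vec.subspace S" and "vec.dim S \<ge> 2"
  obtains x where "x \<in> S" "x \<noteq> 0" "dot v x = 0"
proof -
  obtain B where B: "B \<subseteq> S" "vec.independent B" "card B = vec.dim S"
    using vec.basis_exists by metis
  then obtain B' where "B' \<subseteq> B" "card B' = 2"
    using assms(2) by (metis obtain_subset_with_card_n)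
  then obtain a b where ab: "a \<noteq> b" "{a, b} \<subseteq> B"
    by (auto simp: card_2_iff)
  then have ind: "vec.independent {a, b}"
    using B(2) vec.independent_mono by blast
  then have "a \<noteq> 0"
    using vec.dependent_zero by blast
  have "a \<in> S" "b \<in> S" using ab B by auto
  \<comment> \<open>The combination of two independent vectors on which \<open>dot v\<close>
    cancels; if it is 0, independence forces \<open>dot v a = 0\<close> and \<open>a\<close> itself
    serves.\<close>
  let ?x = "dot v b *s a - dot v a *s b"
  show thesis
  proof (cases "?x = 0")
    case True
    have "dot v a = 0"
    proof (rule ccontr)
      assume nz: "dot v a \<noteq> 0"
      have "b = (inverse (dot v a) * dot v b) *s a"
        using True nz by (simp add: vec_eq_iff field_simps)
      then have "b \<in> vec.span {a}"
        by (metis vec.span_base vec.span_scale singletonI)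
      then show False
        using ind ab(1) by (simp add: insert_commute[of a] vec.independent_insert)
    qed
    then show thesis using that \<open>a \<in> S\<close> \<open>a \<noteq> 0\<close> by blast
  next
    case False
    have "?x \<in> S"
      using S \<open>a \<in> S\<close> \<open>b \<in> S\<close> by (simp add: vec.subspace_diff vec.subspace_scale)
    moreover have "dot v ?x = 0"
      by (simp add: dot_diff_right dot_scale_right)
    ultimately show thesis using that False by blast
  qed
qed

text \<open>Coefficient functions on a basis map onto the subspace, so it has no more elements than
  there are such functions.\<close>

lemma card_subspace_le:
  fixes S :: "('a::{field, finite} ^ 'n::finite) set"
  assumes "vec.subspace S"
  shows "card S \<le> CARD('a) ^ vec.dim S"
proof -
  obtain B where B: "B \<subseteq> S" "S \<subseteq> vec.span B" "card B = vec.dim S"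
    using vec.basis_exists by metis
  let ?g = "\<lambda>u. \<Sum>v\<in>B. u v *s v"
  let ?P = "B \<rightarrow>\<^sub>E (UNIV :: 'a set)"
  have "vec.span B \<subseteq> ?g ` ?P"
  proof
    fix x assume "x \<in> vec.span B"
    then obtain u where "x = ?g u"
      by (auto simp: vec.span_finite)
    then have "x = ?g (restrict u B)"
      by simp
    then show "x \<in> ?g ` ?P"
      by (intro image_eqI[of x _ "restrict u B"]) auto
  qed
  then have "card S \<le> card (?g ` ?P)"
    using B(2) by (intro card_mono) auto
  also have "\<dots> \<le> card ?P"
    by (rule card_image_le) (simp add: finite_PiE)
  also have "\<dots> = CARD('a) ^ vec.dim S"
    by (simp add: card_PiE B(3))
  finally show ?thesis .
qed

section \<open>Codewords and the dimension of the code\<close>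

definition codeword ::
  "('a::{field, finite} ^ 'n::finite \<Rightarrow> 'a) \<Rightarrow> 'a \<Rightarrow> 'a ^ 'n \<Rightarrow> 'a ^ ('a, 'n) nonzero_vec" where
  "codeword f \<alpha> w = (\<chi> j. \<alpha> * f (Rep_nonzero_vec j) + dot w (Rep_nonzero_vec j))"

lemma code_of_eq: "code_of f = {codeword f \<alpha> w | \<alpha> w. True}"
  by (simp add: code_of_def codeword_def)

lemma card_nonzero_vec:
  "CARD(('a::{zero_neq_one, finite}, 'n::finite) nonzero_vec) = CARD('a) ^ CARD('n) - 1"
proof -
  have "CARD(('a, 'n) nonzero_vec) = card {x :: 'a ^ 'n. x \<noteq> 0}"
    by (rule type_definition.card[OF type_definition_nonzero_vec])
  also have "{x :: 'a ^ 'n. x \<noteq> 0} = UNIV - {0}" by auto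
  finally show ?thesis by (simp add: card_Diff_singleton)
qed

text \<open>Since \<open>f 0 = 0\<close>, the origin adds nothing to the count, so weights can be
  computed in the whole space instead of over the coordinate type.\<close>

lemma weight_codeword:
  fixes f :: "'a::{field, finite} ^ 'n::finite \<Rightarrow> 'a"
  assumes "f 0 = 0"
  shows "hamming_weight (codeword f \<alpha> w) = card {x. \<alpha> * f x + dot w x \<noteq> 0}"
proof -
  have "{x. \<alpha> * f x + dot w x \<noteq> 0} = Rep_nonzero_vec ` Supp (codeword f \<alpha> w)"
  proof safe
    fix x assume x: "\<alpha> * f x + dot w x \<noteq> 0"
    then have "x \<noteq> 0" using assms by auto
    then have "x = Rep_nonzero_vec (Abs_nonzero_vec x)"
      by (simp add: Abs_nonzero_vec_inverse)
    moreover have "Abs_nonzero_vec x \<in> Supp (codeword f \<alpha> w)"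
      using x calculation by (simp add: Supp_def codeword_def)
    ultimately show "x \<in> Rep_nonzero_vec ` Supp (codeword f \<alpha> w)" by blast
  qed (simp add: Supp_def codeword_def)
  moreover have "inj_on Rep_nonzero_vec X" for X :: "('a, 'n) nonzero_vec set"
    by (simp add: inj_on_def Rep_nonzero_vec_inject)
  ultimately show ?thesis
    by (simp add: hamming_weight_def card_image)
qed

lemma codeword_eq_0_iff:
  assumes "f 0 = 0"
  shows "codeword f \<alpha> w = 0 \<longleftrightarrow> (\<forall>x. \<alpha> * f x + dot w x = 0)"
  using weight_codeword[of f \<alpha> w, OF assms]
  by (auto simp: hamming_weight_def Supp_def vec_eq_iff codeword_def)

text \<open>Support inclusion read contrapositively. The origin is not a coordinate, but there the
  conclusion holds because \<open>f 0 = 0\<close>.\<close>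

lemma covers_codewordD:
  assumes "f 0 = 0" "covers (codeword f \<beta> v) (codeword f \<alpha> w)" "\<beta> * f x + dot v x = 0"
  shows "\<alpha> * f x + dot w x = 0"
proof (cases "x = 0")
  case False
  then show ?thesis
    using assms(2,3)
    by (auto simp: covers_def Supp_def codeword_def subset_iff Abs_nonzero_vec_inverse
        dest!: spec[of _ "Abs_nonzero_vec x"])
qed (simp add: assms(1))

lemma linear_code_code_of:
  fixes f :: "'a::{field, finite} ^ 'n::finite \<Rightarrow> 'a"
  assumes "f 0 = 0" and nonlinear: "\<And>\<alpha> w. (\<And>x. \<alpha> * f x + dot w x = 0) \<Longrightarrow> \<alpha> = 0"
  shows "linear_code (CARD('a) ^ CARD('n) - 1) (CARD('n) + 1) (code_of f)"
proof -
  \<comment> \<open>Generator matrix whose range is the code: the column \<open>None\<close> carries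
    the values of \<open>f\<close>, the column \<open>Some i\<close> the \<open>i\<close>-th
    coordinates. The extra index accounts for the \<open>+ 1\<close> in the dimension, and
    \<open>nonlinear\<close> makes the map injective.\<close>
  define M :: "'a ^ 'n option ^ ('a, 'n) nonzero_vec" where
    "M = (\<chi> j k. case k of None \<Rightarrow> f (Rep_nonzero_vec j) | Some i \<Rightarrow> Rep_nonzero_vec j $ i)"
  have M: "M *v u = codeword f (u $ None) (\<chi> i. u $ Some i)" for u
    by (simp add: vec_eq_iff M_def codeword_def matrix_vector_mult_def dot_def UNIV_option_conv
        sum.reindex mult.commute)
  have range: "code_of f = range ((*v) M)"
  proof -
    have "codeword f \<alpha> w = M *v (\<chi> k. case k of None \<Rightarrow> \<alpha> | Some i \<Rightarrow> w $ i)" for \<alpha> w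
      by (simp add: M)
    then show ?thesis
      unfolding code_of_eq using M by blast
  qed
  have "u = 0" if "M *v u = 0" for u
  proof -
    have *: "u $ None * f x + dot (\<chi> i. u $ Some i) x = 0" for x
      using that codeword_eq_0_iff[of f, OF assms(1)] by (simp add: M)
    then have "u $ None = 0" by (rule nonlinear)
    moreover from this * have "(\<chi> i. u $ Some i) = 0"
      by (intro dot_eq_0_imp_eq_0) simp
    ultimately show "u = 0"
      by (metis (mono_tags) vec_eq_iff vec_lambda_beta zero_index option.exhaust)
  qed
  then have "inj ((*v) M)"
    by (simp add: vec.linear_inj_iff_eq_0)
  then have "vec.dim (range ((*v) M)) = CARD('n option)"
    by (metis vec.dim_image_eq vec.linear_axioms vec_dim_card vec.span_UNIV)
  moreover have "vec.subspace (range ((*v) M))"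
    by (intro vec.subspace_image vec.subspace_UNIV)
  ultimately show ?thesis
    by (simp add: linear_code_def range card_nonzero_vec card_option)
qed

section \<open>Partial spreads of half-dimensional subspaces\<close>

locale partial_spread =
  fixes W :: "nat \<Rightarrow> (F3 ^ 'n::finite) set" and I A :: "nat set" and t :: nat
  assumes finite_I: "finite I"
    and A_sub: "A \<subseteq> I"
    and A_nonempty: "A \<noteq> {}"
    and t_ge_2: "2 \<le> t"
    and card_n: "CARD('n) = 2 * t"
    and subspace_W: "\<And>i. i \<in> I \<Longrightarrow> vec.subspace (W i)"
    and dim_W: "\<And>i. i \<in> I \<Longrightarrow> vec.dim (W i) = t"
    and W_Int: "\<And>i j. i \<in> I \<Longrightarrow> j \<in> I \<Longrightarrow> i \<noteq> j \<Longrightarrow> W i \<inter> W j = {0}"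
begin

definition f :: "F3 ^ 'n \<Rightarrow> F3" where
  "f x = (\<Sum>i\<in>A. nonzero_indicator (W i) x)"

lemma f_0 [simp]: "f 0 = 0"
  by (simp add: f_def nonzero_indicator_def)

text \<open>A nonzero vector lies in at most one \<open>W i\<close>, so a single summand
  contributes.\<close>

lemma f_eq_1:
  assumes "i \<in> A" "x \<in> W i" "x \<noteq> 0"
  shows "f x = 1"
proof -
  have "x \<notin> W j" if "j \<in> A" "j \<noteq> i" for j
    using W_Int[of i j] that assms A_sub by blast
  then have "f x = (\<Sum>j\<in>A. if j = i then 1 else 0)"
    unfolding f_def using assms by (intro sum.cong) (auto simp: nonzero_indicator_def)
  then show ?thesis
    using assms(1) finite_subset[OF A_sub finite_I] by simp
qed

lemma f_eq_0:
  assumes "\<And>i. i \<in> A \<Longrightarrow> x \<notin> W i"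
  shows "f x = 0"
  using assms by (simp add: f_def nonzero_indicator_def)

lemma f_minus: "f (- x) = f x"
proof -
  have "- x \<in> W i \<longleftrightarrow> x \<in> W i" if "i \<in> A" for i
    using vec.subspace_neg[OF subspace_W] that A_sub by (metis minus_minus subsetD)
  then show ?thesis
    unfolding f_def by (intro sum.cong) (auto simp: nonzero_indicator_def)
qed

section \<open>Linear forms vanishing on members of the spread\<close>

lemma W_sum:
  assumes "i \<in> I" "j \<in> I" "i \<noteq> j"
  obtains y z where "x = y + z" "y \<in> W i" "z \<in> W j"
proof -
  have "vec.dim (W i) + vec.dim (W j) = CARD('n)"
    using dim_W assms card_n by simp
  then obtain y z where "x = y + z" "y \<in> W i" "z \<in> W j"
    by (rule complementary_subspaces_sum[OF subspace_W[OF assms(1)] subspace_W[OF assms(2)]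
        W_Int[OF assms]])
  then show thesis by (rule that)
qed

lemma vanish_two:
  assumes "i \<in> I" "j \<in> I" "i \<noteq> j"
    and "\<And>x. x \<in> W i \<Longrightarrow> dot w x = 0" "\<And>x. x \<in> W j \<Longrightarrow> dot w x = 0"
  shows "w = 0"
proof (rule dot_eq_0_imp_eq_0)
  fix x
  obtain y z where "x = y + z" "y \<in> W i" "z \<in> W j"
    by (rule W_sum[OF assms(1-3)])
  then show "dot w x = 0"
    using assms(4,5) by (simp add: dot_add_right)
qed

lemma W_meets_hyperplane:
  assumes "i \<in> I"
  obtains x where "x \<in> W i" "x \<noteq> 0" "dot v x = 0"
proof -
  have "vec.dim (W i) \<ge> 2"
    using dim_W[OF assms] t_ge_2 by simp
  then obtain x where "x \<in> W i" "x \<noteq> 0" "dot v x = 0"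
    by (rule subspace_meets_hyperplane[OF subspace_W[OF assms]])
  then show thesis by (rule that)
qed

text \<open>\<open>f\<close> is even and \<open>dot w\<close> is odd: evaluating at \<open>x\<close>
  and \<open>- x\<close>, with \<open>x\<close> nonzero in some \<open>W i\<close> and orthogonal to
  \<open>v\<close>, leaves \<open>- \<alpha> = \<alpha>\<close>, hence \<open>\<alpha> = 0\<close>
  in characteristic 3. Taking \<open>v = 0\<close> gives the nonlinearity behind the dimension
  count.\<close>

lemma not_linear_on_hyperplane:
  assumes "\<And>x. dot v x = 0 \<Longrightarrow> \<alpha> * f x + dot w x = 0"
  shows "\<alpha> = 0"
proof -
  obtain i where i: "i \<in> A" "i \<in> I" using A_nonempty A_sub by blast
  obtain x where x: "x \<in> W i" "x \<noteq> 0" "dot v x = 0"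
    by (rule W_meets_hyperplane[OF i(2)])
  have "\<alpha> + dot w x = 0"
    using assms[OF x(3)] f_eq_1[OF i(1) x(1,2)] by simp
  moreover have "\<alpha> - dot w x = 0"
    using assms[of "- x"] x(3) f_eq_1[OF i(1) x(1,2)] by (simp add: dot_minus_right f_minus)
  ultimately have "- \<alpha> = \<alpha>"
    by (simp add: add_eq_0_iff)
  then show ?thesis by (simp add: F3_minus_eq_self)
qed

text \<open>The zeros of \<open>f + dot v\<close> span the whole space. For \<open>v = 0\<close>
  they contain two subspaces with index outside \<open>A\<close>; for nonzero \<open>v\<close> two
  indices inside \<open>A\<close> are used.\<close>

lemma zeros_span:
  assumes inside: "2 \<le> card A" and outside: "2 \<le> card (I - A)"
    and vanish: "\<And>x. f x + dot v x = 0 \<Longrightarrow> dot w x = 0"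
  shows "w = 0"
proof (cases "v = 0")
  case True
  obtain C where "C \<subseteq> I - A" "card C = 2"
    using outside by (metis obtain_subset_with_card_n)
  then obtain i j where ij: "i \<in> I - A" "j \<in> I - A" "i \<noteq> j"
    by (auto simp: card_2_iff)
  have "dot w x = 0" if "x \<in> W k" "k \<in> I - A" for x k
  proof (cases "x = 0")
    case False
    then have "f x = 0"
      using W_Int[of k] that A_sub by (intro f_eq_0) blast
    then show ?thesis using vanish True by simp
  qed simp
  then show ?thesis using ij vanish_two[of i j] by blast
next
  case False
  \<comment> \<open>On nonzero vectors of \<open>W i\<close> the value of \<open>f\<close> is 1, and
    \<open>dot v\<close> equals \<open>-1\<close> at \<open>x\<close> or at \<open>- x\<close>, so
    one of the two is a zero.\<close>
  have off: "dot w x = 0" if i: "i \<in> A" and x: "x \<in> W i" "dot v x \<noteq> 0" for i x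
  proof -
    have "f x = 1" using f_eq_1 i x by force
    then have "f x + dot v x = 0 \<or> f (- x) + dot v (- x) = 0"
      using F3_neq_0_cases[OF x(2)] by (auto simp: f_minus dot_minus_right)
    then show ?thesis
      using vanish[of x] vanish[of "- x"] by (auto simp: dot_minus_right)
  qed
  \<comment> \<open>One \<open>y\<close> outside the hyperplane suffices: if \<open>x\<close> lies
    in the hyperplane, both \<open>x + y\<close> and \<open>y\<close> lie outside it, and
    \<open>x\<close> is their difference.\<close>
  have all: "dot w x = 0" if i: "i \<in> A" and y: "y \<in> W i" "dot v y \<noteq> 0" and x: "x \<in> W i" for i x y
  proof (cases "dot v x = 0")
    case True
    have "x + y \<in> W i" using vec.subspace_add[OF subspace_W] i x y A_sub by blast
    then have "dot w (x + y) = 0"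
      using off[OF i, of "x + y"] True y(2) by (simp add: dot_add_right)
    then show ?thesis using off[OF i y] by (simp add: dot_add_right)
  qed (use off i x in blast)
  obtain C where "C \<subseteq> A" "card C = 2"
    using inside by (metis obtain_subset_with_card_n)
  then obtain i j where ij: "i \<in> A" "j \<in> A" "i \<noteq> j"
    by (auto simp: card_2_iff)
  have inI: "k \<in> I" if "k \<in> A" for k using A_sub that by blast
  have "\<exists>a\<in>A. \<exists>b\<in>A. a \<noteq> b \<and> (\<exists>y\<in>W b. dot v y \<noteq> 0)"
    using vanish_two[of i j v] False ij inI by metis
  then obtain a b y where ab: "a \<in> A" "b \<in> A" "a \<noteq> b" and y: "y \<in> W b" "dot v y \<noteq> 0"
    by blast
  show ?thesis
  proof (cases "\<exists>c\<in>A. c \<noteq> b \<and> (\<exists>z\<in>W c. dot v z \<noteq> 0)")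
    case True
    then obtain c z where "c \<in> A" "c \<noteq> b" "z \<in> W c" "dot v z \<noteq> 0" by blast
    then show ?thesis
      using vanish_two[of b c w] all[of b y] all[of c z] ab y inI by blast
  next
    case only_b: False
    \<comment> \<open>Every \<open>W c\<close> with \<open>c\<close> in \<open>A\<close> other than
      \<open>W b\<close> now lies in the hyperplane of \<open>v\<close>. Two such subspaces would
      force \<open>v = 0\<close>, so \<open>A\<close> is just \<open>a\<close> and
      \<open>b\<close>.\<close>
    have only: "c = a \<or> c = b" if "c \<in> A" for c
      using vanish_two[of a c v] only_b False ab inI that by blast
    obtain z where z: "z \<in> W b" "z \<noteq> 0" "dot v z = 0"
      by (rule W_meets_hyperplane[OF inI[OF ab(2)]])
    have outside_a: "dot w h = 0" if h: "dot v h = 0" "h \<notin> W a" for h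
    proof (cases "h \<in> W b")
      case True
      then show ?thesis using all[OF ab(2) y] by blast
    next
      case nb: False
      then have "f h = 0" using only h(2) by (intro f_eq_0) blast
      then show ?thesis using vanish h(1) by simp
    qed
    have "z \<notin> W a" using W_Int[of a b] z ab inI by blast
    \<comment> \<open>Adding \<open>z\<close> moves a point of \<open>W a\<close> out of
      \<open>W a\<close> while staying in the hyperplane, where \<open>outside_a\<close>
      applies.\<close>
    have hyperplane: "dot w h = 0" if h: "dot v h = 0" for h
    proof (cases "h \<in> W a")
      case True
      have "h + z \<notin> W a"
        using vec.subspace_diff[OF subspace_W, of a "h + z" h] True \<open>z \<notin> W a\<close> ab inI by auto
      then have "dot w (h + z) = 0"
        using h z(3) by (intro outside_a) (simp_all add: dot_add_right)
      then show ?thesis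
        using outside_a[OF z(3) \<open>z \<notin> W a\<close>] by (simp add: dot_add_right)
    qed (use outside_a h in blast)
    obtain c where c: "w = c *s v"
      by (rule orthogonal_subset_imp_multiple[OF False hyperplane])
    \<comment> \<open>As \<open>w\<close> is a multiple of \<open>v\<close> and
      \<open>dot v y\<close> is nonzero, vanishing at \<open>y\<close> makes the factor 0.\<close>
    have "dot w y = 0" using all[OF ab(2) y y(1)] .
    then show ?thesis using y(2) c by (simp add: dot_scale_left)
  qed
qed

section \<open>Minimality and dimension of the spread code\<close>

lemma minimal:
  assumes "2 \<le> card A" "2 \<le> card (I - A)"
  shows "minimal_code (code_of f)"
  unfolding minimal_code_def minimal_codeword_def
proof (intro ballI impI conjI)
  fix c c' assume c: "c \<in> code_of f" "c \<noteq> 0" and c': "c' \<in> code_of f" "c' \<noteq> 0" and cov: "covers c c'"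
  obtain \<beta> v where cdef: "c = codeword f \<beta> v" using c(1) unfolding code_of_eq by blast
  obtain \<alpha> w where c'def: "c' = codeword f \<alpha> w" using c'(1) unfolding code_of_eq by blast
  have zeros: "\<alpha> * f x + dot w x = 0" if "\<beta> * f x + dot v x = 0" for x
    using cov that unfolding cdef c'def by (rule covers_codewordD[of f, OF f_0])
  have "\<exists>d. \<alpha> = d * \<beta> \<and> w = d *s v"
  proof (cases "\<beta> = 0")
    case True
    then have "v \<noteq> 0" using c(2) by (auto simp: cdef codeword_eq_0_iff)
    have "\<alpha> = 0" using not_linear_on_hyperplane[of v \<alpha> w] zeros True by simp
    then have "dot w x = 0" if "dot v x = 0" for x
      using zeros[of x] that True by simp
    then obtain d where "w = d *s v"
      by (rule orthogonal_subset_imp_multiple[OF \<open>v \<noteq> 0\<close>])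
    then show ?thesis using \<open>\<alpha> = 0\<close> True by auto
  next
    case False
    \<comment> \<open>Subtracting \<open>d\<close> times the covering word eliminates
      \<open>f\<close>, leaving the linear word of \<open>w - d *s v\<close>. Scaling by
      \<open>1 / \<beta>\<close> brings the covering word into the form required by
      \<open>zeros_span\<close>.\<close>
    define d where "d = \<alpha> / \<beta>"
    have "w - d *s v = 0"
    proof (rule zeros_span[OF assms])
      fix x assume *: "f x + dot ((1 / \<beta>) *s v) x = 0"
      have "\<beta> * f x + dot v x = \<beta> * (f x + dot ((1 / \<beta>) *s v) x)"
        using False by (simp add: dot_scale_left distrib_left)
      then have z: "\<beta> * f x + dot v x = 0"
        by (simp only: * mult_zero_right)
      then have "d * (\<beta> * f x + dot v x) = 0" by (simp only: mult_zero_right)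
      moreover have "d * (\<beta> * f x + dot v x) = \<alpha> * f x + d * dot v x"
        using False by (simp add: d_def distrib_left)
      moreover have "\<alpha> * f x + dot w x = 0" by (rule zeros[OF z])
      ultimately show "dot (w - d *s v) x = 0"
        by (metis add_left_cancel diff_self dot_diff_left dot_scale_left)
    qed
    then show ?thesis using False by (intro exI[of _ d]) (simp add: d_def)
  qed
  then obtain d where d: "\<alpha> = d * \<beta>" "w = d *s v" by blast
  have "c' = d *s c"
    by (simp add: cdef c'def d codeword_def vec_eq_iff dot_scale_left distrib_left mult.assoc)
  then show "\<exists>d. d \<noteq> 0 \<and> c' = d *s c" using c'(2) by auto
qed auto

lemma linear_code: "linear_code (3 ^ CARD('n) - 1) (CARD('n) + 1) (code_of f)"
  unfolding card_F3[symmetric]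
proof (rule linear_code_code_of)
  fix \<alpha> w assume "\<And>x. \<alpha> * f x + dot w x = 0"
  then show "\<alpha> = 0" by (rule not_linear_on_hyperplane)
qed (rule f_0)

section \<open>Minimum and maximum weights\<close>

lemma wt_min_le: "wt_min (code_of f) \<le> card A * 3 ^ t"
proof -
  \<comment> \<open>The word of \<open>f\<close> itself, supported in the union of the chosen
    subspaces.\<close>
  let ?c = "codeword f 1 0"
  have "?c \<noteq> 0"
    using not_linear_on_hyperplane[of 0 1 0] by (auto simp: codeword_eq_0_iff)
  then have "wt_min (code_of f) \<le> hamming_weight ?c"
    unfolding wt_min_def by (intro Min_le) (auto simp: code_of_eq)
  also have "\<dots> = card {x. f x \<noteq> 0}"
    by (simp add: weight_codeword)
  also have "\<dots> \<le> card (\<Union>i\<in>A. W i)"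
    using f_eq_0 by (intro card_mono) auto
  also have "\<dots> \<le> (\<Sum>i\<in>A. card (W i))"
    using finite_subset[OF A_sub finite_I] by (rule card_UN_le)
  also have "\<dots> \<le> (\<Sum>i\<in>A. 3 ^ t)"
  proof (rule sum_mono)
    fix i assume "i \<in> A"
    then show "card (W i) \<le> 3 ^ t"
      using card_subspace_le[OF subspace_W] dim_W A_sub by (metis card_F3 subsetD)
  qed
  finally show ?thesis by simp
qed

text \<open>Translation by a coordinate vector shows that a coordinate function has at most as many zeros
  as nonzeros.\<close>

lemma wt_max_ge: "3 ^ (2 * t) \<le> 2 * wt_max (code_of f)"
proof -
  fix k :: 'n
  let ?c = "codeword f 0 (axis k 1)"
  have dk: "dot (axis k 1) x = x $ k" for x :: "F3 ^ 'n"
    using dot_axis[of x k] by (simp add: dot_def mult.commute)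
  let ?Z = "{x :: F3 ^ 'n. x $ k = 0}" and ?N = "{x :: F3 ^ 'n. x $ k \<noteq> 0}"
  have "card ?Z \<le> card ?N"
    by (rule card_inj_on_le[of "\<lambda>x. x + axis k 1"]) (auto simp: inj_on_def axis_def)
  moreover have "card ?Z + card ?N = card (?Z \<union> ?N)"
    by (rule card_Un_disjoint[symmetric]) auto
  moreover have "?Z \<union> ?N = UNIV" by auto
  moreover have "CARD(F3 ^ 'n) = 3 ^ (2 * t)"
    by (simp add: card_F3 card_n)
  ultimately have "3 ^ (2 * t) \<le> 2 * card ?N" by simp
  also have "card ?N = hamming_weight ?c"
    by (simp add: weight_codeword dk)
  also have "?c \<noteq> 0"
    by (auto simp: codeword_eq_0_iff dk intro!: exI[of _ "axis k 1"])
  then have "hamming_weight ?c \<le> wt_max (code_of f)"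
    unfolding wt_max_def by (intro Max_ge) (auto simp: code_of_eq)
  finally show ?thesis by simp
qed

text \<open>The two weight bounds even give a ratio of at most 2/9.\<close>

lemma weight_ratio:
  assumes "card A \<le> 3 ^ (t - 2)"
  shows "real (wt_min (code_of f)) / real (wt_max (code_of f)) \<le> 1 / 3"
proof -
  have "wt_min (code_of f) \<le> 3 ^ (t - 2) * 3 ^ t"
    using wt_min_le mult_right_mono[OF assms, of "3 ^ t"] by (rule order_trans) simp
  \<comment> \<open>The factor \<open>9 = 3 ^ 2\<close> restores the exponent \<open>t - 2\<close>
    to \<open>t\<close>; \<open>t_ge_2\<close> makes this natural subtraction exact.\<close>
  then have "9 * wt_min (code_of f) \<le> 3 ^ 2 * (3 ^ (t - 2) * 3 ^ t)"
    by simp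
  also have "\<dots> = 3 ^ (2 * t)"
    unfolding power_add[symmetric] using t_ge_2 by (intro arg_cong[of _ _ "\<lambda>k. 3 ^ k"]) simp
  finally have "9 * wt_min (code_of f) \<le> 2 * wt_max (code_of f)"
    using wt_max_ge by simp
  moreover have "0 < wt_max (code_of f)"
    using wt_max_ge by (cases "wt_max (code_of f) = 0") auto
  ultimately show ?thesis by (simp add: field_simps)
qed

end

section \<open>The ternary codes from a family of \<open>3 ^ t + 1\<close> subspaces\<close>

theorem theorem4p4:
  fixes W :: "nat \<Rightarrow> (F3 ^ 'n::finite) set"
    and A :: "nat set"
    and f :: "F3 ^ 'n \<Rightarrow> F3"
    and n t s :: nat
  assumes "n = CARD('n)"
    and "n \<ge> 6"
    and "even n"
    and "t = n div 2"
    and "\<And>i. i \<in> {1..3 ^ t + 1} \<Longrightarrow> vec.subspace (W i) \<and> vec.dim (W i) = t"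
    and "\<And>i j. i \<in> {1..3 ^ t + 1} \<Longrightarrow> j \<in> {1..3 ^ t + 1} \<Longrightarrow> i \<noteq> j \<Longrightarrow> W i \<inter> W j = {0}"
    and "1 \<le> s" "s \<le> 3 ^ t + 1"
    and "A \<subseteq> {1..3 ^ t + 1}" "card A = s"
    and "f = (\<lambda>x. \<Sum>i\<in>A. nonzero_indicator (W i) x)"
  shows "(s \<notin> {1, 3 ^ t, 3 ^ t + 1} \<longrightarrow>
            linear_code (3 ^ n - 1) (n + 1) (code_of f) \<and> minimal_code (code_of f))
       \<and> (s \<le> 3 ^ (t - 2) \<longrightarrow>
            real (wt_min (code_of f)) / real (wt_max (code_of f)) \<le> 1 / 3 \<and> (1 / 3 :: real) < 2 / 3)"
proof -
  have n: "n = 2 * t" and t: "2 \<le> t" using assms(2-4) by auto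
  interpret ps: partial_spread W "{1..3 ^ t + 1}" A t
    using assms(1,5-10) n t by unfold_locales auto
  have f: "f = ps.f"
    by (simp add: assms(11) ps.f_def fun_eq_iff)
  show ?thesis
  proof (intro conjI impI)
    assume s: "s \<notin> {1, 3 ^ t, 3 ^ t + 1}"
    \<comment> \<open>Excluding the three values of \<open>s\<close> means exactly that at least two
      indices lie in \<open>A\<close> and at least two outside it.\<close>
    then have "2 \<le> card A" "s + 2 \<le> 3 ^ t + 1" using assms(7,8,10) by auto
    moreover have "card ({1..3 ^ t + 1} - A) = 3 ^ t + 1 - s"
      using assms(9,10) finite_subset[OF assms(9)] by (simp add: card_Diff_subset)
    ultimately show "minimal_code (code_of f)"
      unfolding f by (intro ps.minimal) auto
    show "linear_code (3 ^ n - 1) (n + 1) (code_of f)"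
      using ps.linear_code by (simp add: f assms(1))
  next
    assume "s \<le> 3 ^ (t - 2)"
    then show "real (wt_min (code_of f)) / real (wt_max (code_of f)) \<le> 1 / 3"
      using ps.weight_ratio by (simp add: f assms(10))
  qed simp
qed

end
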